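(* There exists a plane graph $G$ such that $\chi_{\mathrm{fum}}(G) > 4$; that is, there exists a plane graph $G$ that has no facial unique-maximum coloring using colors from $\{1,2,3,4\}$.
   Context: Graphs are finite and simple. A plane graph is a graph together with a fixed embedding in the plane without crossing edges; its faces include the outer (unbounded) face. A vertex coloring is proper if adjacent vertices receive distinct colors. A facial unique-maximum coloring (FUM-coloring) of a plane graph is a proper vertex coloring by natural numbers such that, for every face $\alpha$ (including the outer face), the maximum color among the vertices incident with $\alpha$ is attained by exactly one vertex incident with $\alpha$ (a vertex is counted once even if it occurs several times along the boundary of $\alpha$). The facial unique-maximum chromatic number $\chi_{\mathrm{fum}}(G)$ is the minimum $k$ such that $G$ has a FUM-coloring using colors from $\{1,2,\ldots,k\}$. Plane graphs are not assumed to be highly connected. *)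

theory Defs
  imports "HOL-Analysis.Analysis" "HOL-Library.Extended_Nat"
begin

record 'a drawn_graph =
  verts :: "'a set"
  edges :: "'a set set"
  point :: "'a \<Rightarrow> complex"
  curve :: "'a set \<Rightarrow> real \<Rightarrow> complex"

text \<open>Graphs are nonempty. This matters: the only face of the empty drawing has no
  incident vertex, so the empty graph would have no facial unique-maximum coloring at all.\<close>

definition finite_simple_graph :: "'a set \<Rightarrow> 'a set set \<Rightarrow> bool" where
  "finite_simple_graph V E \<longleftrightarrow>
     finite V \<and> V \<noteq> {} \<and> (\<forall>e\<in>E. e \<subseteq> V \<and> card e = 2)"

text \<open>A crossing-free embedding in the plane, identified with \<^typ>\<open>complex\<close>: vertices are
  distinct points, an edge is an arc joining its two end vertices and passing through no other
  vertex, and two edges meet only in common end vertices.\<close>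

definition plane_graph :: "'a drawn_graph \<Rightarrow> bool" where
  "plane_graph G \<longleftrightarrow>
     finite_simple_graph (verts G) (edges G) \<and>
     inj_on (point G) (verts G) \<and>
     (\<forall>e\<in>edges G. arc (curve G e) \<and>
        {pathstart (curve G e), pathfinish (curve G e)} = point G ` e \<and>
        path_image (curve G e) \<inter> point G ` verts G = point G ` e) \<and>
     (\<forall>e\<in>edges G. \<forall>f\<in>edges G. e \<noteq> f \<longrightarrow>
        path_image (curve G e) \<inter> path_image (curve G f) = point G ` (e \<inter> f))"

definition drawing :: "'a drawn_graph \<Rightarrow> complex set" where
  "drawing G = point G ` verts G \<union> (\<Union>e\<in>edges G. path_image (curve G e))"

definition faces :: "'a drawn_graph \<Rightarrow> complex set set" where
  "faces G = components (- drawing G)"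

definition incident_verts :: "'a drawn_graph \<Rightarrow> complex set \<Rightarrow> 'a set" where
  "incident_verts G F = {v \<in> verts G. point G v \<in> frontier F}"

definition proper_coloring :: "'a drawn_graph \<Rightarrow> ('a \<Rightarrow> nat) \<Rightarrow> bool" where
  "proper_coloring G c \<longleftrightarrow>
     (\<forall>u\<in>verts G. \<forall>v\<in>verts G. {u, v} \<in> edges G \<longrightarrow> c u \<noteq> c v)"

definition fum_coloring :: "'a drawn_graph \<Rightarrow> ('a \<Rightarrow> nat) \<Rightarrow> bool" where
  "fum_coloring G c \<longleftrightarrow> proper_coloring G c \<and>
     (\<forall>F\<in>faces G. \<exists>!v. v \<in> incident_verts G F \<and> c v = Max (c ` incident_verts G F))"

definition fum_colorable :: "'a drawn_graph \<Rightarrow> nat \<Rightarrow> bool" where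
  "fum_colorable G k \<longleftrightarrow> (\<exists>c. fum_coloring G c \<and> c ` verts G \<subseteq> {1..k})"

text \<open>An infimum in \<^typ>\<open>enat\<close> rather than a least natural number, so that no unspecified value
  can arise; over a nonempty set of numbers the infimum is the minimum.\<close>

definition chi_fum :: "'a drawn_graph \<Rightarrow> enat" where
  "chi_fum G = Inf (enat ` {k. fum_colorable G k})"

end

theory Submission
  imports Defs
begin

text \<open>
  Let \<open>H\<close> be a triangle \<open>abc\<close> around a hexagonal face \<open>x\<^sub>a\<^sub>b y\<^sub>b x\<^sub>b\<^sub>c y\<^sub>c x\<^sub>c\<^sub>a y\<^sub>a\<close>, where \<open>x\<^sub>u\<^sub>v\<close> is joined
  to \<open>u\<close> and \<open>v\<close>, and \<open>y\<^sub>u\<close> is joined to \<open>u\<close>. If \<open>a\<close>, \<open>b\<close>, \<open>c\<close> use the colors 1, 2, 3,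
  then each of the three paths \<open>x\<^sub>u\<^sub>v y\<^sub>v x\<^sub>v\<^sub>w\<close> of the hexagon contains a vertex of color 4: otherwise
  \<open>x\<^sub>u\<^sub>v\<close> has the color of \<open>w\<close> and \<open>x\<^sub>v\<^sub>w\<close> that of \<open>u\<close>, and no color remains for \<open>y\<^sub>v\<close>. One vertex lies on
  at most two of the paths, so color 4 occurs twice on the hexagonal face. Hence every coloring with
  four colors uses color 4 on the triangle of each copy of \<open>H\<close>. The graph consists of two copies of
  \<open>H\<close> whose triangles lie on a common face, so that color 4 occurs twice on that face.
\<close>

section \<open>Straight-line drawings\<close>

text \<open>Twice the signed area of the triangle \<open>p q z\<close>: an affine function of
  \<open>z\<close> that vanishes at \<open>p\<close> and \<open>q\<close>.\<close>

definition orient :: "complex \<Rightarrow> complex \<Rightarrow> complex \<Rightarrow> real" where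
  "orient p q z = (Re q - Re p) * (Im z - Im p) - (Im q - Im p) * (Re z - Re p)"

lemma orient_convex_combination:
  "orient p q ((1 - u) *\<^sub>R r + u *\<^sub>R s) = (1 - u) * orient p q r + u * orient p q s"
  by (simp add: orient_def algebra_simps)

lemma orient_eq_0_if_in_closed_segment:
  assumes "z \<in> closed_segment p q"
  shows "orient p q z = 0"
proof -
  obtain u where "z = (1 - u) *\<^sub>R p + u *\<^sub>R q"
    using assms by (auto simp: closed_segment_def)
  then show ?thesis
    by (simp only: orient_convex_combination) (simp add: orient_def)
qed

text \<open>\<open>orient p q\<close> vanishes on the segment \<open>p q\<close>, whereas by
  affinity it keeps the common sign of \<open>r\<close> and \<open>s\<close> along the segment
  \<open>r s\<close>.\<close>

lemma closed_segments_disjoint_if_same_side: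
  assumes "orient p q r * orient p q s > 0"
  shows "closed_segment p q \<inter> closed_segment r s = {}"
proof -
  have False if "z \<in> closed_segment p q" and z: "z \<in> closed_segment r s" for z
  proof -
    obtain u where u: "0 \<le> u" "u \<le> 1" "z = (1 - u) *\<^sub>R r + u *\<^sub>R s"
      using z by (auto simp: closed_segment_def)
    have eq: "(1 - u) * orient p q r + u * orient p q s = 0"
      using orient_eq_0_if_in_closed_segment[OF that(1)] u(3) orient_convex_combination by metis
    \<comment> \<open>Multiplying by \<open>orient p q r\<close> makes both summands nonnegative,
      whichever sign \<open>r\<close> and \<open>s\<close> share.\<close>
    have "0 = ((1 - u) * orient p q r + u * orient p q s) * orient p q r"
      by (simp add: eq)
    also have "\<dots> = (1 - u) * (orient p q r)\<^sup>2 + u * (orient p q r * orient p q s)"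
      by (simp add: algebra_simps power2_eq_square)
    also have "\<dots> > 0"
    proof (cases "u = 0")
      case True
      then show ?thesis using assms by auto
    next
      case False
      then have "u * (orient p q r * orient p q s) > 0"
        using u(1) assms by (intro mult_pos_pos[of u]) auto
      then show ?thesis using u(2) by (intro add_nonneg_pos) auto
    qed
    finally show False by simp
  qed
  then show ?thesis by blast
qed

text \<open>Along the second segment \<open>orient p q\<close> equals
  \<open>u * orient p q s\<close>, which is zero only at \<open>u = 0\<close>, that is, at
  \<open>p\<close>.\<close>

lemma closed_segments_Int_common_endpoint:
  assumes "orient p q s \<noteq> 0"
  shows "closed_segment p q \<inter> closed_segment p s = {p}"
proof -
  have "z = p" if "z \<in> closed_segment p q" and z: "z \<in> closed_segment p s" for z
  proof -
    obtain u where u: "z = (1 - u) *\<^sub>R p + u *\<^sub>R s"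
      using z by (auto simp: closed_segment_def)
    have "(1 - u) * orient p q p + u * orient p q s = 0"
      using orient_eq_0_if_in_closed_segment[OF that(1)] u orient_convex_combination by metis
    moreover have "orient p q p = 0"
      by (simp add: orient_def)
    ultimately show ?thesis
      using assms u by simp
  qed
  then show ?thesis by auto
qed

section \<open>Integer coordinates, for which sign conditions can be evaluated\<close>

definition grid_point :: "int \<times> int \<Rightarrow> complex" where
  "grid_point p = Complex (of_int (fst p)) (of_int (snd p))"

definition grid_orient :: "int \<times> int \<Rightarrow> int \<times> int \<Rightarrow> int \<times> int \<Rightarrow> int" where
  "grid_orient p q r =
     (fst q - fst p) * (snd r - snd p) - (snd q - snd p) * (fst r - fst p)"

lemma orient_grid_point:
  "orient (grid_point p) (grid_point q) (grid_point r) = of_int (grid_orient p q r)"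
  by (simp add: orient_def grid_point_def grid_orient_def)

lemma inj_grid_point: "inj grid_point"
  by (auto intro!: injI prod_eqI simp: grid_point_def)

text \<open>An executable certificate that two segments meet in common ends only: with a shared end
  they are not collinear, otherwise one of them lies strictly on one side of the line through the
  other.\<close>

definition compatible :: "(nat \<Rightarrow> int \<times> int) \<Rightarrow> nat \<times> nat \<Rightarrow> nat \<times> nat \<Rightarrow> bool" where
  "compatible P e f = (case e of (i, j) \<Rightarrow> case f of (k, l) \<Rightarrow>
     if i = k then grid_orient (P i) (P j) (P l) \<noteq> 0
     else if i = l then grid_orient (P i) (P j) (P k) \<noteq> 0
     else if j = k then grid_orient (P j) (P i) (P l) \<noteq> 0
     else if j = l then grid_orient (P j) (P i) (P k) \<noteq> 0
     else grid_orient (P i) (P j) (P k) * grid_orient (P i) (P j) (P l) > 0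
        \<or> grid_orient (P k) (P l) (P i) * grid_orient (P k) (P l) (P j) > 0)"

lemma compatible_Int:
  fixes P :: "nat \<Rightarrow> int \<times> int"
  defines "p \<equiv> \<lambda>i. grid_point (P i)"
  assumes "compatible P (i, j) (k, l)"
  shows "closed_segment (p i) (p j) \<inter> closed_segment (p k) (p l) = p ` ({i, j} \<inter> {k, l})"
proof -
  have shared: "closed_segment (p x) (p y) \<inter> closed_segment (p x) (p z) = p ` ({x, y} \<inter> {x, z})"
    if "grid_orient (P x) (P y) (P z) \<noteq> 0" for x y z
  proof -
    have "y \<noteq> z"
      using that by (auto simp: grid_orient_def)
    then have "{x, y} \<inter> {x, z} = {x}" by auto
    moreover have "orient (p x) (p y) (p z) \<noteq> 0"
      using that by (simp add: p_def orient_grid_point)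
    ultimately show ?thesis
      using closed_segments_Int_common_endpoint by (simp only: image_insert image_empty)
  qed
  have separated: "closed_segment (p w) (p x) \<inter> closed_segment (p y) (p z) = {}"
    if "grid_orient (P w) (P x) (P y) * grid_orient (P w) (P x) (P z) > 0" for w x y z
    by (rule closed_segments_disjoint_if_same_side)
      (use that in \<open>simp add: p_def orient_grid_point flip: of_int_mult\<close>)
  consider "i = k" | "i = l" "i \<noteq> k" | "j = k" "i \<noteq> k" "i \<noteq> l"
    | "j = l" "i \<noteq> k" "i \<noteq> l" "j \<noteq> k" | "i \<noteq> k" "i \<noteq> l" "j \<noteq> k" "j \<noteq> l"
    by blast
  then show ?thesis
  proof cases
    case 1
    then show ?thesis using shared[of i j l] assms(2) by (simp add: compatible_def)
  next
    case 2
    then show ?thesis using shared[of i j k] assms(2)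
      by (simp add: compatible_def closed_segment_commute[of "p k"] insert_commute[of k])
  next
    case 3
    then show ?thesis using shared[of j i l] assms(2)
      by (simp add: compatible_def closed_segment_commute[of "p i"] insert_commute[of i])
  next
    case 4
    then show ?thesis using shared[of j i k] assms(2)
      by (simp add: compatible_def closed_segment_commute[of "p i"] closed_segment_commute[of "p k"]
          insert_commute[of i] insert_commute[of k])
  next
    case 5
    then show ?thesis using separated[of i j k l] separated[of k l i j] assms(2)
      by (auto simp: compatible_def)
  qed
qed

text \<open>Curves are indexed by unordered edges, so \<open>Min\<close> and \<open>Max\<close> fix
  a direction.\<close>

definition straight_drawing ::
  "nat \<Rightarrow> (nat \<times> nat) list \<Rightarrow> (nat \<Rightarrow> int \<times> int) \<Rightarrow> nat drawn_graph" where
  "straight_drawing n es P =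
     \<lparr>verts = {..<n}, edges = (\<lambda>(i, j). {i, j}) ` set es, point = \<lambda>i. grid_point (P i),
      curve = \<lambda>e. linepath (grid_point (P (Min e))) (grid_point (P (Max e)))\<rparr>"

text \<open>Every vertex is an end of some edge, so the vertices add no points to the
  segments.\<close>

lemma drawing_straight_drawing:
  assumes "\<And>i j. (i, j) \<in> set es \<Longrightarrow> i < j"
    and "\<And>v. v < n \<Longrightarrow> \<exists>(i, j)\<in>set es. v = i \<or> v = j"
  shows "drawing (straight_drawing n es P) =
    (\<Union>(i, j)\<in>set es. closed_segment (grid_point (P i)) (grid_point (P j)))"
proof -
  have "point (straight_drawing n es P) ` verts (straight_drawing n es P)
     \<subseteq> (\<Union>(i, j)\<in>set es. closed_segment (grid_point (P i)) (grid_point (P j)))"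
    using assms(2) by (fastforce simp: straight_drawing_def)
  moreover have "(\<Union>e\<in>edges (straight_drawing n es P). path_image (curve (straight_drawing n es P) e))
     = (\<Union>(i, j)\<in>set es. closed_segment (grid_point (P i)) (grid_point (P j)))"
    using assms(1) by (force simp: straight_drawing_def)
  ultimately show ?thesis by (auto simp: drawing_def)
qed

lemma plane_graph_straight_drawing:
  assumes n: "n > 0"
    and es: "\<And>i j. (i, j) \<in> set es \<Longrightarrow> i < j \<and> j < n"
    and cover: "\<And>v. v < n \<Longrightarrow> \<exists>(i, j)\<in>set es. v = i \<or> v = j"
    and inj: "inj_on P {..<n}"
    and compatible: "\<And>e f. e \<in> set es \<Longrightarrow> f \<in> set es \<Longrightarrow> e \<noteq> f \<Longrightarrow> compatible P e f"
  shows "plane_graph (straight_drawing n es P)" (is "plane_graph ?G")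
proof -
  define p where "p = (\<lambda>i. grid_point (P i))"
  have inj_p: "inj_on p {..<n}"
    using inj by (simp add: p_def inj_on_def inj_eq[OF inj_grid_point])
  have edgeE: "\<exists>i j. (i, j) \<in> set es \<and> i < j \<and> j < n \<and> e = {i, j}" if "e \<in> edges ?G" for e
    using that es by (fastforce simp: straight_drawing_def)
  have curve: "curve ?G {i, j} = linepath (p i) (p j)" if "i < j" for i j
    using that by (simp add: straight_drawing_def p_def)
  have [simp]: "verts ?G = {..<n}" "point ?G = p"
    by (auto simp: straight_drawing_def p_def)
  have meet: "path_image (curve ?G e) \<inter> path_image (curve ?G f) = p ` (e \<inter> f)"
    if "e \<in> edges ?G" "f \<in> edges ?G" "e \<noteq> f" for e f
  proof -
    obtain i j where e: "(i, j) \<in> set es" "i < j" "e = {i, j}"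
      using edgeE[OF \<open>e \<in> edges ?G\<close>] by blast
    obtain k l where f: "(k, l) \<in> set es" "k < l" "f = {k, l}"
      using edgeE[OF \<open>f \<in> edges ?G\<close>] by blast
    have "(i, j) \<noteq> (k, l)"
      using e f that(3) by auto
    then show ?thesis
      using compatible_Int[OF compatible[OF e(1) f(1)]] e f
      by (simp add: curve p_def)
  qed
  have arc: "arc (curve ?G e) \<and> {pathstart (curve ?G e), pathfinish (curve ?G e)} = p ` e \<and>
      path_image (curve ?G e) \<inter> p ` {..<n} = p ` e" if e: "e \<in> edges ?G" for e
  proof -
    obtain i j where ij: "i < j" "j < n" "e = {i, j}"
      using edgeE[OF e] by blast
    have "p i \<noteq> p j"
      using ij inj_p by (auto simp: inj_on_def)
    \<comment> \<open>That an edge avoids all other vertices follows from \<open>meet\<close>, since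
      each vertex \<open>v\<close> is an end of some edge \<open>{k, l}\<close>.\<close>
    moreover have "p v \<in> p ` e" if v: "v < n" "p v \<in> path_image (curve ?G e)" for v
    proof -
      obtain k l where kl: "(k, l) \<in> set es" "v \<in> {k, l}"
        using cover[OF v(1)] by auto
      then have f: "{k, l} \<in> edges ?G"
        by (force simp: straight_drawing_def)
      have "p v \<in> path_image (curve ?G {k, l})"
        using kl es[OF kl(1)] curve[of k l] by auto
      then show ?thesis
        using meet[OF e f] v(2) kl(2) by (cases "e = {k, l}") auto
    qed
    ultimately show ?thesis
      using ij by (auto simp: curve)
  qed
  have "finite_simple_graph (verts ?G) (edges ?G)"
    using n edgeE by (fastforce simp: finite_simple_graph_def)
  then show ?thesis
    using inj_p arc meet by (simp add: plane_graph_def)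
qed

section \<open>Colors on a face\<close>

text \<open>The face is the component of \<open>z\<close>. It contains the open segment from each
  \<open>v\<close> in \<open>S\<close> to \<open>z\<close>, so the point of \<open>v\<close> lies in
  its closure, but not in its interior, being on the drawing.\<close>

lemma common_face_if_visible:
  assumes "\<And>v. v \<in> S \<Longrightarrow> v \<in> verts G"
    and "\<And>v. v \<in> S \<Longrightarrow> closed_segment (point G v) z \<inter> drawing G \<subseteq> {point G v}"
    and z: "z \<notin> drawing G"
  shows "\<exists>F\<in>faces G. S \<subseteq> incident_verts G F"
proof -
  let ?F = "connected_component_set (- drawing G) z"
  have "v \<in> incident_verts G ?F" if v: "v \<in> S" for v
  proof -
    have in_drawing: "point G v \<in> drawing G"
      using assms(1)[OF v] by (auto simp: drawing_def)
    then have neq: "point G v \<noteq> z" using z by auto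
    have "open_segment (point G v) z \<inter> drawing G = {}"
      using assms(2)[OF v] by (auto simp: open_segment_def)
    moreover have "connected (insert z (open_segment (point G v) z))"
    proof (rule connected_intermediate_closure)
      show "connected (open_segment (point G v) z)"
        by (intro convex_connected convex_open_segment)
      show "insert z (open_segment (point G v) z) \<subseteq> closure (open_segment (point G v) z)"
        using neq open_closed_segment by (auto simp: closure_open_segment)
    qed auto
    ultimately have "insert z (open_segment (point G v) z) \<subseteq> ?F"
      using z by (intro connected_component_maximal) auto
    then have "closure (open_segment (point G v) z) \<subseteq> closure ?F"
      by (intro closure_mono) auto
    then have "point G v \<in> closure ?F"
      using neq by (auto simp: closure_open_segment)
    moreover have "point G v \<notin> interior ?F"
      using in_drawing interior_subset connected_component_subset by blast
    ultimately show ?thesis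
      using assms(1)[OF v] by (simp add: incident_verts_def frontier_def)
  qed
  moreover have "?F \<in> faces G"
    using z by (auto simp: faces_def components_def)
  ultimately show ?thesis by blast
qed

text \<open>The viewpoint is given as an extra index \<open>z\<close> beyond the vertices, so that
  \<open>compatible\<close> applies to lines of sight \<open>(v, z)\<close> as if they were
  edges.\<close>

lemma common_face_straight_drawing:
  assumes "\<And>i j. (i, j) \<in> set es \<Longrightarrow> i < j \<and> j < n"
    and "\<And>v. v < n \<Longrightarrow> \<exists>(i, j)\<in>set es. v = i \<or> v = j"
    and "z \<ge> n" "S \<noteq> {}"
    and S: "\<And>v. v \<in> S \<Longrightarrow> v < n"
    and compatible: "\<And>v e. v \<in> S \<Longrightarrow> e \<in> set es \<Longrightarrow> compatible P (v, z) e"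
    and "P z \<notin> P ` {..<n}"
  shows "\<exists>F\<in>faces (straight_drawing n es P). S \<subseteq> incident_verts (straight_drawing n es P) F"
proof -
  define p where "p = (\<lambda>i. grid_point (P i))"
  let ?G = "straight_drawing n es P"
  have [simp]: "verts ?G = {..<n}" "point ?G = p"
    by (auto simp: straight_drawing_def p_def)
  have "drawing ?G = (\<Union>(i, j)\<in>set es. closed_segment (p i) (p j))"
    using drawing_straight_drawing[of es n P] assms(1,2) by (auto simp: p_def)
  moreover have "closed_segment (p v) (p z) \<inter> closed_segment (p i) (p j) \<subseteq> {p v}"
    if "v \<in> S" "(i, j) \<in> set es" for v i j
    using compatible_Int[OF compatible[OF that]] assms(1)[OF that(2)] \<open>z \<ge> n\<close>
    by (auto simp: p_def)
  ultimately have visible: "closed_segment (p v) (p z) \<inter> drawing ?G \<subseteq> {p v}" if "v \<in> S" for v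
    using that by blast
  obtain v where v: "v \<in> S" using \<open>S \<noteq> {}\<close> by auto
  have "p z \<noteq> p v"
    using S[OF v] \<open>P z \<notin> P ` {..<n}\<close> inj_grid_point by (auto simp: p_def inj_eq)
  \<comment> \<open>\<open>p z\<close> is itself on the line of sight from \<open>p v\<close>, so on
    the drawing it would have to equal \<open>p v\<close>.\<close>
  then have "p z \<notin> drawing ?G"
    using visible[OF v] by auto
  then show ?thesis
    using common_face_if_visible[of S ?G "p z"] visible S by auto
qed

lemma top_color_once_on_face:
  assumes "fum_coloring G c" "finite (verts G)" "\<And>v. v \<in> verts G \<Longrightarrow> c v \<le> k"
    and "F \<in> faces G" "u \<in> incident_verts G F" "v \<in> incident_verts G F" "c u = k" "c v = k"
  shows "u = v"
proof -
  let ?I = "incident_verts G F"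
  have "finite ?I" "?I \<subseteq> verts G"
    using assms(2) by (auto simp: incident_verts_def)
  then have "Max (c ` ?I) = k"
    using assms by (intro Max_eqI) auto
  then show ?thesis
    using assms by (auto simp: fum_coloring_def)
qed

section \<open>The chromatic number as a threshold\<close>

lemma fum_colorable_mono:
  "fum_colorable G k \<Longrightarrow> k \<le> l \<Longrightarrow> fum_colorable G l"
  by (fastforce simp: fum_colorable_def)

lemma chi_fum_gt_iff: "chi_fum G > enat k \<longleftrightarrow> \<not> fum_colorable G k"
proof
  assume "chi_fum G > enat k"
  then show "\<not> fum_colorable G k"
    by (auto simp: chi_fum_def not_le[symmetric] intro: Inf_lower)
next
  assume not_colorable: "\<not> fum_colorable G k"
  have "enat (Suc k) \<le> chi_fum G"
    unfolding chi_fum_def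
  proof (rule Inf_greatest)
    fix x assume "x \<in> enat ` {k. fum_colorable G k}"
    then obtain l where "x = enat l" "fum_colorable G l" by auto
    then show "enat (Suc k) \<le> x"
      using not_colorable fum_colorable_mono[of G l k] by (cases "l \<le> k") auto
  qed
  then show "chi_fum G > enat k"
    by (simp add: Suc_ile_eq)
qed

section \<open>The counterexample\<close>

text \<open>The vertices \<open>a\<close>, \<open>b\<close>, \<open>c\<close> of the first copy of \<open>H\<close> are 0, 1, 2, its hexagon is 3, ..., 8
  with 3 joined to \<open>a\<close> and \<open>b\<close>; the second copy is shifted by 9 and reflected in the origin. The
  edges joining the copies only serve to make the graph connected.\<close>

definition H_edges :: "(nat \<times> nat) list" where
  "H_edges = [(0,1), (1,2), (0,2), (3,4), (4,5), (5,6), (6,7), (7,8), (3,8),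
     (0,3), (1,3), (1,4), (1,5), (2,5), (2,6), (2,7), (0,7), (0,8)]"

definition G_edges :: "(nat \<times> nat) list" where
  "G_edges = H_edges @ map (\<lambda>(i, j). (i + 9, j + 9)) H_edges @ [(2,9), (0,11)]"

text \<open>The last three points are no vertices: each sees, along straight lines, the vertices of one of
  the three faces that matter.\<close>

definition G_points :: "(int \<times> int) list" where
  "G_points =
    [(-6,4), (-1,0), (-6,-6), (-4,1), (-3,-1), (-3,-2), (-4,-2), (-5,-1), (-5,0),
     (6,-4), (1,0), (6,6), (4,-1), (3,1), (3,2), (4,2), (5,1), (5,0),
     (0,0), (-4,-1), (4,1)]"

definition G :: "nat drawn_graph" where
  "G = straight_drawing 18 G_edges (nth G_points)"

lemma G_edges_bounds: "(i, j) \<in> set G_edges \<Longrightarrow> i < j \<and> j < 18"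
proof -
  have "\<forall>(i, j)\<in>set G_edges. i < j \<and> j < 18"
    by code_simp
  then show "(i, j) \<in> set G_edges \<Longrightarrow> i < j \<and> j < 18" by auto
qed

lemma G_edges_cover: "v < 18 \<Longrightarrow> \<exists>(i, j)\<in>set G_edges. v = i \<or> v = j"
proof -
  have "\<forall>v\<in>set [0..<18]. \<exists>(i, j)\<in>set G_edges. v = i \<or> v = j"
    by code_simp
  then show "v < 18 \<Longrightarrow> \<exists>(i, j)\<in>set G_edges. v = i \<or> v = j" by simp
qed

lemma plane_graph_G: "plane_graph G"
  unfolding G_def
proof (rule plane_graph_straight_drawing)
  have "distinct (take 18 G_points)" "length G_points = 21"
    by code_simp+
  then show "inj_on (nth G_points) {..<18}"
    by (auto simp: inj_on_def distinct_conv_nth)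
  have "\<forall>e\<in>set G_edges. \<forall>f\<in>set G_edges. e \<noteq> f \<longrightarrow> compatible (nth G_points) e f"
    by code_simp
  then show "compatible (nth G_points) e f"
    if "e \<in> set G_edges" "f \<in> set G_edges" "e \<noteq> f" for e f
    using that by blast
qed (use G_edges_bounds G_edges_cover in auto)

text \<open>Index 18 is the origin, between the two triangles; 19 and 20 lie inside the two
  hexagons.\<close>

lemma common_faces_G:
  fixes z :: nat
  assumes "(z, S) \<in> {(18, {0, 1, 2, 9, 10, 11}), (19, {3..8}), (20, {12..17})}"
  shows "\<exists>F\<in>faces G. S \<subseteq> incident_verts G F"
  unfolding G_def
proof (rule common_face_straight_drawing[where z = z])
  have "\<forall>(z, vs)\<in>set [(18, [0, 1, 2, 9, 10, 11]), (19, [3..<9]), (20, [12..<18])].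
      \<forall>v\<in>set vs. \<forall>e\<in>set G_edges. compatible (nth G_points) (v, z) e"
    by code_simp
  then show "compatible (nth G_points) (v, z) e" if "v \<in> S" "e \<in> set G_edges" for v e
    using assms that by (auto simp del: upt_rec_numeral)
  have "\<forall>z\<in>set [18, 19, 20]. \<forall>v\<in>set [0..<18]. G_points ! z \<noteq> G_points ! v"
    by code_simp
  then show "G_points ! z \<notin> (!) G_points ` {..<18}"
    using assms by auto
qed (use assms G_edges_bounds G_edges_cover in auto)

text \<open>As \<open>a\<close>, \<open>b\<close>, \<open>c\<close> exhaust the three colors,
  \<open>x = c\<close> and \<open>x' = a\<close>, so \<open>y\<close> would have to avoid all of
  them.\<close>

lemma no_color_for_middle_vertex:
  fixes a b c x y x' :: nat
  assumes "{a, b, c, x, y, x'} \<subseteq> {1..3}" "distinct [a, b, c]"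
    and "x \<noteq> a" "x \<noteq> b" "x' \<noteq> b" "x' \<noteq> c" "y \<noteq> b" "x \<noteq> y" "y \<noteq> x'"
  shows False
proof -
  have "{a, b, c} = {1..3}"
    using assms(1,2) by (intro card_subset_eq) auto
  then have "x \<in> {a, b, c}" "y \<in> {a, b, c}" "x' \<in> {a, b, c}"
    using assms(1) by auto
  then show False
    using assms(3-) by auto
qed

text \<open>The offset \<open>k\<close> selects the copy of \<open>H\<close>.\<close>

lemma triangle_has_color_4:
  assumes c: "fum_coloring G c" "c ` verts G \<subseteq> {1..4}"
    and k: "k = 0 \<or> k = 9"
  shows "\<exists>v\<in>{k, k + 1, k + 2}. c v = 4"
proof (rule ccontr)
  assume no4: "\<not> ?thesis"
  have range: "1 \<le> c v \<and> c v \<le> 4" if "v < 18" for v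
    using c(2) that by (force simp: G_def straight_drawing_def)
  have proper: "c (k + i) \<noteq> c (k + j)" if "(i, j) \<in> set H_edges" for i j
  proof -
    have e: "(k + i, k + j) \<in> set G_edges"
      using that k by (force simp: G_edges_def)
    moreover have "k + i < 18" "k + j < 18"
      using G_edges_bounds[OF e] by auto
    ultimately show ?thesis
      using c(1) by (force simp: fum_coloring_def proper_coloring_def G_def straight_drawing_def)
  qed
  obtain F where F: "F \<in> faces G" "{k + 3..k + 8} \<subseteq> incident_verts G F"
    using common_faces_G[of 19 "{3..8}"] common_faces_G[of 20 "{12..17}"] k by auto
  have once: "i = j" if "i \<in> {3..8}" "j \<in> {3..8}" "c (k + i) = 4" "c (k + j) = 4" for i j
  proof -
    have "k + i \<in> incident_verts G F" "k + j \<in> incident_verts G F"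
      using F(2) that by auto
    then have "k + i = k + j"
      using top_color_once_on_face[OF c(1), of 4 F "k + i" "k + j"] range that F(1)
      by (auto simp: G_def straight_drawing_def)
    then show ?thesis by simp
  qed
  have in3: "c (k + i) \<in> {1..3}" if "i < 9" "c (k + i) \<noteq> 4" for i
    using range[of "k + i"] that k by auto
  have tri: "c (k + 0) \<in> {1..3}" "c (k + 1) \<in> {1..3}" "c (k + 2) \<in> {1..3}"
    using no4 by (intro in3; simp)+
  \<comment> \<open>Here \<open>u\<close>, \<open>v\<close>, \<open>w\<close> are the triangle and
    \<open>x\<close>, \<open>y\<close>, \<open>x'\<close> the hexagon path around
    \<open>v\<close>.\<close>
  have path: "\<exists>i\<in>{x, y, x'}. c (k + i) = 4"
    if "x < 9" "y < 9" "x' < 9" "{c (k + u), c (k + v), c (k + w)} \<subseteq> {1..3}"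
      "distinct [c (k + u), c (k + v), c (k + w)]"
      "c (k + x) \<noteq> c (k + u)" "c (k + x) \<noteq> c (k + v)" "c (k + x') \<noteq> c (k + v)"
      "c (k + x') \<noteq> c (k + w)" "c (k + y) \<noteq> c (k + v)" "c (k + x) \<noteq> c (k + y)"
      "c (k + y) \<noteq> c (k + x')" for u v w x y x'
  proof (rule ccontr)
    assume "\<not> ?thesis"
    then have "{c (k + x), c (k + y), c (k + x')} \<subseteq> {1..3}"
      using in3 that(1-3) by auto
    then show False
      using that no_color_for_middle_vertex[of "c (k + u)" "c (k + v)" "c (k + w)"
          "c (k + x)" "c (k + y)" "c (k + x')"] by auto
  qed
  \<comment> \<open>Both directions are recorded, as the three rotations of \<open>path\<close> use
    edges in either order.\<close>
  have ne: "list_all (\<lambda>(i, j). c (k + i) \<noteq> c (k + j) \<and> c (k + j) \<noteq> c (k + i)) H_edges"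
    using proper by (fastforce simp: list_all_iff)
  note ne = ne[unfolded H_edges_def list.pred_inject prod.case]
  have "\<exists>i\<in>{3, 4, 5}. c (k + i) = 4"
    by (rule path[of _ _ _ 0 1 2]) (use tri ne in auto)
  moreover have "\<exists>i\<in>{5, 6, 7}. c (k + i) = 4"
    by (rule path[of _ _ _ 1 2 0]) (use tri ne in auto)
  moreover have "\<exists>i\<in>{7, 8, 3}. c (k + i) = 4"
    by (rule path[of _ _ _ 2 0 1]) (use tri ne in auto)
  ultimately obtain i j l where "i \<in> {3, 4, 5}" "j \<in> {5, 6, 7}" "l \<in> {7, 8, 3}"
    "c (k + i) = 4" "c (k + j) = 4" "c (k + l) = 4" by blast
  \<comment> \<open>The three paths overlap pairwise in one vertex, but no vertex lies on all of
    them.\<close>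
  moreover from this have "i = j" "j = l"
    by (auto intro!: once)
  ultimately show False by auto
qed

lemma G_not_fum_4_colorable: "\<not> (\<exists>c. fum_coloring G c \<and> c ` verts G \<subseteq> {1..4})"
proof clarify
  fix c assume c: "fum_coloring G c" "c ` verts G \<subseteq> {1..4}"
  have "\<exists>u\<in>{0, 1, 2}. c u = 4" "\<exists>v\<in>{9, 10, 11}. c v = 4"
    using triangle_has_color_4[OF c, of 0] triangle_has_color_4[OF c, of 9]
    by (simp_all add: numeral_2_eq_2)
  then obtain u v where uv: "u \<in> {0, 1, 2}" "c u = 4" "v \<in> {9, 10, 11}" "c v = 4"
    by blast
  obtain F where F: "F \<in> faces G" "{0, 1, 2, 9, 10, 11} \<subseteq> incident_verts G F"
    using common_faces_G[of 18 "{0, 1, 2, 9, 10, 11}"] by blast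
  have "finite (verts G)" "\<And>w. w \<in> verts G \<Longrightarrow> c w \<le> 4"
    using c(2) by (auto simp: G_def straight_drawing_def)
  moreover have "u \<in> incident_verts G F" "v \<in> incident_verts G F"
    using F(2) uv by auto
  ultimately have "u = v"
    using top_color_once_on_face[OF c(1)] F(1) uv(2,4) by blast
  then show False using uv by auto
qed

theorem proposition1:
  "\<exists>G :: nat drawn_graph. plane_graph G \<and> chi_fum G > 4 \<and>
     \<not> (\<exists>c. fum_coloring G c \<and> c ` verts G \<subseteq> {1..4})"
proof (intro exI conjI)
  show "chi_fum G > 4"
    using chi_fum_gt_iff[of 4 G] G_not_fum_4_colorable by (simp add: fum_colorable_def numeral_eq_enat)
qed (fact plane_graph_G G_not_fum_4_colorable)+

end
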